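(* Let $p$ be a prime, $q$ a power of $p$, and $k\ge 0$ an integer. The map $\bar{\mathcal{B}}_k:\mathbf{F}_q^2\to\mathbf{F}_q^2$ obtained by reducing the integer coefficients of $\mathcal{B}_k$ modulo $p$ is a permutation of $\mathbf{F}_q^2$ if and only if $\gcd(q^4-1,k)=1$.
   Context: Define $\varPhi_{B_2}:\mathbf{C}^2\to\mathbf{C}^2$ by $\varPhi_{B_2}(\sigma,\tau)=\bigl(e^{2\pi i\sigma}+e^{-2\pi i\sigma}+e^{2\pi i\tau}+e^{-2\pi i\tau},\ (e^{2\pi i\sigma}+e^{-2\pi i\sigma})(e^{2\pi i\tau}+e^{-2\pi i\tau})\bigr)$. For each integer $k\ge 0$, $\mathcal{B}_k:\mathbf{C}^2\to\mathbf{C}^2$ denotes the unique polynomial map (it has integer coefficients) satisfying $\varPhi_{B_2}(k\sigma,k\tau)=\mathcal{B}_k(\varPhi_{B_2}(\sigma,\tau))$ for all $\sigma,\tau\in\mathbf{C}$; e.g. $\mathcal{B}_0=(4,4)$, $\mathcal{B}_1(x,y)=(x,y)$, $\mathcal{B}_2(x,y)=(x^2-2y-4,y^2-2x^2+4y+4)$. This is the family associated with the Lie algebra $B_2\cong C_2$. *)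

theory Defs
  imports Complex_Main "HOL-Computational_Algebra.Computational_Algebra"
begin

text \<open>
  A bivariate polynomial over a ring \<open>R\<close> is an element of \<open>R[x][y]\<close>, i.e. of type
  \<open>'a poly poly\<close>: the outer variable is \<open>y\<close>, the coefficients are polynomials in \<open>x\<close>.
\<close>

definition poly2 :: "'a::comm_ring_1 poly poly \<Rightarrow> 'a \<Rightarrow> 'a \<Rightarrow> 'a" where
  "poly2 P x y = poly (poly P [:y:]) x"

definition poly2_map ::
  "'a::comm_ring_1 poly poly \<times> 'a poly poly \<Rightarrow> 'a \<times> 'a \<Rightarrow> 'a \<times> 'a" where
  "poly2_map F z = (poly2 (fst F) (fst z) (snd z), poly2 (snd F) (fst z) (snd z))"

text \<open>
  The image of an integer polynomial under the canonical map from the integers to any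
  commutative ring; for a field of characteristic \<open>p\<close> this is reduction of the
  coefficients modulo \<open>p\<close>.
\<close>

definition of_int_poly2 :: "int poly poly \<Rightarrow> 'a::comm_ring_1 poly poly" where
  "of_int_poly2 P = map_poly (map_poly of_int) P"

definition int_poly2_map ::
  "int poly poly \<times> int poly poly \<Rightarrow> 'a::comm_ring_1 \<times> 'a \<Rightarrow> 'a \<times> 'a" where
  "int_poly2_map F = poly2_map (of_int_poly2 (fst F), of_int_poly2 (snd F))"

definition Phi_B2 :: "complex \<times> complex \<Rightarrow> complex \<times> complex" where
  "Phi_B2 = (\<lambda>(\<sigma>, \<tau>).
     (exp (2 * pi * \<i> * \<sigma>) + exp (- (2 * pi * \<i> * \<sigma>))
        + exp (2 * pi * \<i> * \<tau>) + exp (- (2 * pi * \<i> * \<tau>)),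
      (exp (2 * pi * \<i> * \<sigma>) + exp (- (2 * pi * \<i> * \<sigma>)))
        * (exp (2 * pi * \<i> * \<tau>) + exp (- (2 * pi * \<i> * \<tau>)))))"

text \<open>
  Existence of such an integer pair, and its uniqueness even among pairs of complex
  polynomials, are shown in \<open>B2_poly_eqn\<close> and \<open>B2_poly_unique\<close> below.
\<close>

definition B2_poly :: "nat \<Rightarrow> int poly poly \<times> int poly poly" where
  "B2_poly k = (THE F. \<forall>\<sigma> \<tau>.
     Phi_B2 (of_nat k * \<sigma>, of_nat k * \<tau>) = int_poly2_map F (Phi_B2 (\<sigma>, \<tau>)))"


subsection \<open>Well-definedness\<close>

lemma poly2_simps [simp]:
  "poly2 (P + Q) x y = poly2 P x y + poly2 Q x y"
  "poly2 (P - Q) x y = poly2 P x y - poly2 Q x y"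
  "poly2 (- P) x y = - poly2 P x y"
  "poly2 (P * Q) x y = poly2 P x y * poly2 Q x y"
  "poly2 0 x y = 0"
  "poly2 1 x y = 1"
  "poly2 [:[:0, 1:]:] x y = x"
  "poly2 [:0, 1:] x y = y"
  by (simp_all add: poly2_def)

lemma coeff_of_int_poly2:
  "coeff (coeff (of_int_poly2 P :: 'a::comm_ring_1 poly poly) i) j = of_int (coeff (coeff P i) j)"
  by (simp add: of_int_poly2_def coeff_map_poly)

lemma poly2_eqI: "(\<And>i j. coeff (coeff P i) j = coeff (coeff Q i) j) \<Longrightarrow> P = Q"
  by (simp add: poly_eq_iff)

lemma of_int_poly2_simps [simp]:
  "of_int_poly2 (P + Q) = of_int_poly2 P + of_int_poly2 Q"
  "of_int_poly2 (P - Q) = of_int_poly2 P - of_int_poly2 Q"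
  "of_int_poly2 (- P) = - of_int_poly2 P"
  "of_int_poly2 (P * Q) = of_int_poly2 P * of_int_poly2 Q"
  "of_int_poly2 0 = 0"
  "of_int_poly2 1 = 1"
  "of_int_poly2 [:[:0, 1:]:] = [:[:0, 1:]:]"
  "of_int_poly2 [:0, 1:] = [:0, 1:]"
  by (rule poly2_eqI;
      simp add: coeff_of_int_poly2 coeff_mult coeff_sum coeff_pCons coeff_1 split: nat.splits)+

lemma of_int_poly2_inj:
  assumes "(of_int_poly2 P :: complex poly poly) = of_int_poly2 Q"
  shows "P = Q"
proof (rule poly2_eqI)
  fix i j
  have "(of_int (coeff (coeff P i) j) :: complex) = of_int (coeff (coeff Q i) j)"
    using assms by (metis coeff_of_int_poly2)
  then show "coeff (coeff P i) j = coeff (coeff Q i) j"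
    by simp
qed

lemma poly2_eq_0:
  fixes P :: "complex poly poly"
  assumes "\<And>x y. poly2 P x y = 0"
  shows "P = 0"
proof -
  have 1: "poly P [:y:] = 0" for y
    using assms by (metis poly2_def poly_0 poly_eq_poly_eq_iff ext)
  have "infinite (range (\<lambda>y::complex. [:y:]))"
    by (subst finite_image_iff) (auto simp: inj_on_def infinite_UNIV_char_0)
  moreover have "range (\<lambda>y::complex. [:y:]) \<subseteq> {z. poly P z = 0}"
    using 1 by auto
  ultimately show ?thesis
    using poly_roots_finite finite_subset by blast
qed

lemma Phi_B2_surj: "\<exists>\<sigma> \<tau>. Phi_B2 (\<sigma>, \<tau>) = (x, y)"
proof -
  have quad: "\<exists>z::complex. z\<^sup>2 = b * z - c" for b c
  proof
    have "((b + csqrt (b\<^sup>2 - 4 * c)) / 2)\<^sup>2 - b * ((b + csqrt (b\<^sup>2 - 4 * c)) / 2)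
      = ((csqrt (b\<^sup>2 - 4 * c))\<^sup>2 - b\<^sup>2) / 4"
      by (simp add: power2_eq_square field_simps)
    then show "((b + csqrt (b\<^sup>2 - 4 * c)) / 2)\<^sup>2 = b * ((b + csqrt (b\<^sup>2 - 4 * c)) / 2) - c"
      by (simp add: diff_eq_eq)
  qed
  have trig: "\<exists>\<sigma>. exp (2 * pi * \<i> * \<sigma>) + exp (- (2 * pi * \<i> * \<sigma>)) = u" for u
  proof -
    obtain z where z: "z\<^sup>2 = u * z - 1" using quad by blast
    then have z0: "z \<noteq> 0" by auto
    have "exp (of_real (ln (cmod z)) + \<i> * of_real (Arg z)) = rcis (cmod z) (Arg z)"
      using z0 by (simp add: exp_add exp_of_real cis_conv_exp rcis_def)
    then obtain w where w: "z = exp w" by (metis rcis_cmod_Arg)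
    have "exp w + exp (- w) = u"
      using z z0 by (simp add: w[symmetric] exp_minus power2_eq_square field_simps)
    then show ?thesis by (intro exI[of _ "w / (2 * pi * \<i>)"]) simp
  qed
  obtain u where u: "u\<^sup>2 = x * u - y" using quad by blast
  obtain \<sigma> where \<sigma>: "exp (2 * pi * \<i> * \<sigma>) + exp (- (2 * pi * \<i> * \<sigma>)) = u"
    using trig by blast
  obtain \<tau> where \<tau>: "exp (2 * pi * \<i> * \<tau>) + exp (- (2 * pi * \<i> * \<tau>)) = x - u"
    using trig by blast
  have "u + (x - u) = x" and "u * (x - u) = y"
    using u by (simp_all add: algebra_simps power2_eq_square)
  then have "Phi_B2 (\<sigma>, \<tau>) = (x, y)"
    by (simp only: Phi_B2_def prod.case add.assoc[of _ "exp (2 * pi * \<i> * \<tau>)"] \<sigma> \<tau>)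
  then show ?thesis by blast
qed

lemma poly2_map_unique:
  assumes "\<And>\<sigma> \<tau>. poly2_map F (Phi_B2 (\<sigma>, \<tau>)) = poly2_map G (Phi_B2 (\<sigma>, \<tau>))"
  shows "F = G"
proof -
  have "poly2_map F (x, y) = poly2_map G (x, y)" for x y
    using assms Phi_B2_surj by metis
  then have "poly2 (fst F - fst G) x y = 0" "poly2 (snd F - snd G) x y = 0" for x y
    by (simp_all add: poly2_map_def)
  then have "fst F - fst G = 0" "snd F - snd G = 0"
    using poly2_eq_0 by blast+
  then show ?thesis by (simp add: prod_eq_iff)
qed

lemma B2_poly_exists:
  "\<exists>F. \<forall>\<sigma> \<tau>. Phi_B2 (of_nat k * \<sigma>, of_nat k * \<tau>) = int_poly2_map F (Phi_B2 (\<sigma>, \<tau>))"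
proof -
  define e where "e n s = exp (2 * pi * \<i> * (of_nat n * s)) + exp (- (2 * pi * \<i> * (of_nat n * s)))"
    for n and s :: complex
  let ?X = "[:[:0, 1:]:] :: int poly poly" and ?Y = "[:0, 1:] :: int poly poly"
  let ?ev = "\<lambda>P. poly2 (of_int_poly2 P :: complex poly poly)"
  define good where "good n A B \<longleftrightarrow>
      (\<forall>s t. let x = e 1 s + e 1 t; y = e 1 s * e 1 t in e n s = ?ev A x y + ?ev B x y * e 1 s)" for n A B
  have rec: "e (Suc (Suc n)) s = e 1 s * e (Suc n) s - e n s" for n s
  proof -
    have "exp (m + 2 * w) + exp (- (m + 2 * w)) =
      (exp w + exp (- w)) * (exp (m + w) + exp (- (m + w))) - (exp m + exp (- m))" for m w :: complex
      by (simp add: algebra_simps mult_exp_exp)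
    from this[of "2 * pi * \<i> * (of_nat n * s)" "2 * pi * \<i> * s"] show ?thesis
      by (simp add: e_def algebra_simps)
  qed
  have ex: "\<exists>A B A' B'. good n A B \<and> good (Suc n) A' B'" for n
  proof (induction n)
    case 0
    have "good 0 (1 + 1) 0" "good (Suc 0) 0 1"
      by (simp_all only: good_def Let_def of_int_poly2_simps poly2_simps) (simp_all add: e_def)
    then show ?case by blast
  next
    case (Suc n)
    then obtain A B A' B' where g: "good n A B" and g': "good (Suc n) A' B'" by blast
    have "good (Suc (Suc n)) (- (?Y * B') - A) (A' + ?X * B' - B)"
      unfolding good_def Let_def
    proof (intro allI)
      fix s t
      let ?x = "e 1 s + e 1 t" and ?y = "e 1 s * e 1 t"
      have 1: "e n s = ?ev A ?x ?y + ?ev B ?x ?y * e 1 s"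
        using g by (simp add: good_def Let_def)
      have 2: "e (Suc n) s = ?ev A' ?x ?y + ?ev B' ?x ?y * e 1 s"
        using g' by (simp add: good_def Let_def)
      show "e (Suc (Suc n)) s = ?ev (- (?Y * B') - A) ?x ?y + ?ev (A' + ?X * B' - B) ?x ?y * e 1 s"
        unfolding rec 1 2 of_int_poly2_simps poly2_simps by (simp add: algebra_simps)
    qed
    with g' show ?case by blast
  qed
  obtain A B where g: "good k A B" using ex by blast
  let ?F = "(A + A + B * ?X, A * A + A * B * ?X + B * B * ?Y)"
  have "Phi_B2 (of_nat k * \<sigma>, of_nat k * \<tau>) = int_poly2_map ?F (Phi_B2 (\<sigma>, \<tau>))" for \<sigma> \<tau>
  proof -
    have Phi: "Phi_B2 (of_nat n * \<sigma>, of_nat n * \<tau>) = (e n \<sigma> + e n \<tau>, e n \<sigma> * e n \<tau>)" for n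
      by (simp add: Phi_B2_def e_def)
    let ?x = "e 1 \<sigma> + e 1 \<tau>" and ?y = "e 1 \<sigma> * e 1 \<tau>"
    have 1: "e k \<sigma> = ?ev A ?x ?y + ?ev B ?x ?y * e 1 \<sigma>"
      using g by (simp add: good_def Let_def)
    have 2: "e k \<tau> = ?ev A ?x ?y + ?ev B ?x ?y * e 1 \<tau>"
      using g[unfolded good_def Let_def, rule_format, of \<tau> \<sigma>] by (simp add: add.commute mult.commute)
    have "Phi_B2 (\<sigma>, \<tau>) = (?x, ?y)" using Phi[of 1] by simp
    moreover have "e k \<sigma> + e k \<tau> = fst (int_poly2_map ?F (?x, ?y))"
      unfolding 1 2 int_poly2_map_def poly2_map_def fst_conv snd_conv of_int_poly2_simps poly2_simps
      by (simp add: algebra_simps)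
    moreover have "e k \<sigma> * e k \<tau> = snd (int_poly2_map ?F (?x, ?y))"
      unfolding 1 2 int_poly2_map_def poly2_map_def fst_conv snd_conv of_int_poly2_simps poly2_simps
      by (simp add: algebra_simps)
    ultimately show ?thesis by (simp add: Phi)
  qed
  then show ?thesis by blast
qed

lemma B2_poly_eqn:
  "Phi_B2 (of_nat k * \<sigma>, of_nat k * \<tau>) = int_poly2_map (B2_poly k) (Phi_B2 (\<sigma>, \<tau>))"
proof -
  obtain F where F: "\<forall>\<sigma> \<tau>. Phi_B2 (of_nat k * \<sigma>, of_nat k * \<tau>) = int_poly2_map F (Phi_B2 (\<sigma>, \<tau>))"
    using B2_poly_exists by blast
  have "G = F" if "\<forall>\<sigma> \<tau>. Phi_B2 (of_nat k * \<sigma>, of_nat k * \<tau>) = int_poly2_map G (Phi_B2 (\<sigma>, \<tau>))" for G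
  proof -
    have "(of_int_poly2 (fst G) :: complex poly poly, of_int_poly2 (snd G) :: complex poly poly)
        = (of_int_poly2 (fst F), of_int_poly2 (snd F))"
      by (rule poly2_map_unique) (metis F that int_poly2_map_def)
    then show ?thesis by (auto simp: prod_eq_iff dest: of_int_poly2_inj)
  qed
  with F have "B2_poly k = F"
    unfolding B2_poly_def by (intro the_equality) blast+
  with F show ?thesis by simp
qed

lemma B2_poly_unique:
  assumes "\<And>\<sigma> \<tau>. Phi_B2 (of_nat k * \<sigma>, of_nat k * \<tau>) = poly2_map G (Phi_B2 (\<sigma>, \<tau>))"
  shows "G = (of_int_poly2 (fst (B2_poly k)), of_int_poly2 (snd (B2_poly k)))"
  by (rule poly2_map_unique) (metis assms B2_poly_eqn int_poly2_map_def)

end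

theory Submission
  imports "HOL-Algebra.Algebraic_Closure_Type" "HOL-Number_Theory.Residues" Defs
begin

text \<open>
  Writing \<open>(x, y) = (u + v, u v)\<close> identifies points of the affine plane over the field with \<open>q\<close>
  elements with unordered pairs \<open>{u, v}\<close> in an algebraic closure that are stable under Frobenius;
  such \<open>u\<close> and \<open>v\<close> lie in the field with \<open>q\<^sup>2\<close> elements. In these coordinates the map is
  \<open>{u, v} \<mapsto> {D u, D v}\<close> with the Dickson polynomial \<open>D\<close> determined by
  \<open>D (a + 1/a) = a ^ k + 1/a ^ k\<close>. If \<open>a + 1/a\<close> is fixed by \<open>q\<^sup>2\<close>-Frobenius, then
  \<open>a ^ (q\<^sup>2 - 1) = 1\<close> or \<open>a ^ (q\<^sup>2 + 1) = 1\<close>, so \<open>a\<close> is a root of unity of order dividing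
  \<open>q ^ 4 - 1\<close>. Hence \<open>D\<close> is injective on the field with \<open>q\<^sup>2\<close> elements when \<open>k\<close> is coprime to
  \<open>q ^ 4 - 1\<close>, and otherwise a root of unity of prime order dividing both gives a collision.
\<close>

section \<open>Dickson polynomials and the integer pair \<open>B2_poly k\<close>\<close>

fun dickson :: "nat \<Rightarrow> 'a::comm_ring_1 \<Rightarrow> 'a" where
  "dickson 0 u = 2"
| "dickson (Suc 0) u = u"
| "dickson (Suc (Suc n)) u = u * dickson (Suc n) u - dickson n u"

lemma dickson_add_inverse:
  fixes a :: "'a::field"
  assumes "a \<noteq> 0"
  shows "dickson n (a + inverse a) = a ^ n + inverse a ^ n"
proof (induction n "a + inverse a" rule: dickson.induct)
  case (3 n)
  then show ?case
    using assms by (simp add: power_inverse field_simps)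
qed simp_all

text \<open>
  Coefficients \<open>(A, B)\<close> with \<open>dickson n u = A + B u\<close> modulo \<open>u\<^sup>2 = x u - y\<close>.
\<close>

fun dickson_rem :: "nat \<Rightarrow> int poly poly \<times> int poly poly" where
  "dickson_rem 0 = (1 + 1, 0)"
| "dickson_rem (Suc 0) = (0, 1)"
| "dickson_rem (Suc (Suc n)) =
    (- ([:0, 1:] * snd (dickson_rem (Suc n))) - fst (dickson_rem n),
     fst (dickson_rem (Suc n)) + [:[:0, 1:]:] * snd (dickson_rem (Suc n)) - snd (dickson_rem n))"

text \<open>For \<open>x = u + v\<close> and \<open>y = u * v\<close>, \<open>u\<close> is a root of
  \<open>T\<^sup>2 - x T + y\<close>, so the Dickson recursion closes up on expressions linear in
  \<open>u\<close>.\<close>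

lemma dickson_eq_rem:
  fixes u v :: "'a::comm_ring_1"
  shows "dickson n u = poly2 (of_int_poly2 (fst (dickson_rem n))) (u + v) (u * v)
    + poly2 (of_int_poly2 (snd (dickson_rem n))) (u + v) (u * v) * u"
proof (induction n rule: dickson_rem.induct)
  case (3 n)
  show ?case
    unfolding dickson.simps dickson_rem.simps fst_conv snd_conv of_int_poly2_simps poly2_simps
    by (subst 3(1), subst 3(2)) (simp add: algebra_simps)
qed (simp_all only: dickson.simps dickson_rem.simps fst_conv snd_conv of_int_poly2_simps
       poly2_simps, simp_all)

text \<open>Sum and product of \<open>A + B u\<close> and \<open>A + B v\<close>, written in
  \<open>x = u + v\<close> and \<open>y = u v\<close>.\<close>

definition B2_dickson :: "nat \<Rightarrow> int poly poly \<times> int poly poly" where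
  "B2_dickson k = (let (A, B) = dickson_rem k in
     (A + A + B * [:[:0, 1:]:], A * A + A * B * [:[:0, 1:]:] + B * B * [:0, 1:]))"

lemma int_poly2_map_B2_dickson:
  fixes u v :: "'a::comm_ring_1"
  shows "int_poly2_map (B2_dickson k) (u + v, u * v)
    = (dickson k u + dickson k v, dickson k u * dickson k v)"
proof -
  obtain A B where AB: "dickson_rem k = (A, B)" by fastforce
  let ?ev = "\<lambda>P. poly2 (of_int_poly2 P) (u + v) (u * v)"
  have u: "dickson k u = ?ev A + ?ev B * u"
    using dickson_eq_rem[of k u v] by (simp add: AB)
  have v: "dickson k v = ?ev A + ?ev B * v"
    using dickson_eq_rem[of k v u] by (simp add: AB add.commute mult.commute)
  show ?thesis
    unfolding u v B2_dickson_def AB Let_def prod.case int_poly2_map_def poly2_map_def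
      fst_conv snd_conv of_int_poly2_simps poly2_simps
    by (simp add: algebra_simps)
qed

text \<open>By uniqueness it suffices to compare on the image of \<open>Phi_B2\<close>, where
  \<open>a = exp (2 * pi * \<i> * s)\<close> turns multiplication of \<open>s\<close> by
  \<open>k\<close> into the \<open>k\<close>-th power of \<open>a\<close>. The Dickson description
  is then available over every commutative ring.\<close>

lemma B2_poly_eq_dickson: "B2_poly k = B2_dickson k"
proof -
  let ?G = "(of_int_poly2 (fst (B2_dickson k)), of_int_poly2 (snd (B2_dickson k)))
    :: complex poly poly \<times> complex poly poly"
  have "Phi_B2 (of_nat k * \<sigma>, of_nat k * \<tau>) = poly2_map ?G (Phi_B2 (\<sigma>, \<tau>))" for \<sigma> \<tau>
  proof -
    define e where "e s = exp (2 * pi * \<i> * s)" for s :: complex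
    have dick: "dickson k (e s + inverse (e s)) = e (of_nat k * s) + inverse (e (of_nat k * s))" for s
    proof -
      have "e (of_nat k * s) = e s ^ k"
        by (simp add: e_def exp_of_nat_mult[symmetric] mult_ac)
      then show ?thesis
        by (subst dickson_add_inverse) (simp_all add: e_def power_inverse)
    qed
    have Phi: "Phi_B2 (s, t) = (e s + inverse (e s) + (e t + inverse (e t)),
        (e s + inverse (e s)) * (e t + inverse (e t)))" for s t
      by (simp add: Phi_B2_def e_def exp_minus add.assoc)
    show ?thesis
      unfolding Phi int_poly2_map_def[symmetric] int_poly2_map_B2_dickson dick ..
  qed
  from B2_poly_unique[OF this] show ?thesis
    by (auto simp: prod_eq_iff dest: of_int_poly2_inj)
qed

lemma int_poly2_map_B2_poly:
  fixes u v :: "'a::comm_ring_1"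
  shows "int_poly2_map (B2_poly k) (u + v, u * v)
    = (dickson k u + dickson k v, dickson k u * dickson k v)"
  by (simp add: B2_poly_eq_dickson int_poly2_map_B2_dickson)

section \<open>Passage to the algebraic closure\<close>

lemma to_ac_poly_of_int:
  fixes x :: "'a::field"
  shows "to_ac (poly (map_poly of_int P) x) = poly (map_poly of_int P) (to_ac x)"
  by (induction P) (simp_all add: map_poly_pCons)

lemma to_ac_poly2_of_int:
  fixes x y :: "'a::field"
  shows "to_ac (poly2 (of_int_poly2 P) x y) = poly2 (of_int_poly2 P) (to_ac x) (to_ac y)"
  by (induction P)
    (simp_all add: poly2_def of_int_poly2_def map_poly_pCons to_ac_poly_of_int)

lemma map_prod_to_ac_int_poly2_map:
  fixes z :: "'a::field \<times> 'a"
  shows "map_prod to_ac to_ac (int_poly2_map F z) = int_poly2_map F (map_prod to_ac to_ac z)"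
  by (cases z) (simp add: int_poly2_map_def poly2_map_def to_ac_poly2_of_int)

section \<open>Root pairs, sums \<open>a + inverse a\<close> and roots of unity\<close>

lemma add_inverse_eq_iff:
  fixes a b :: "'a::field"
  assumes "a \<noteq> 0" "b \<noteq> 0"
  shows "a + inverse a = b + inverse b \<longleftrightarrow> a = b \<or> a = inverse b"
proof -
  have "(a + inverse a - (b + inverse b)) * (a * b) = (a - b) * (a * b - 1)"
    using assms by (simp add: field_simps)
  moreover have "a = inverse b \<longleftrightarrow> a * b - 1 = 0"
    using assms by (auto simp: field_simps)
  ultimately show ?thesis
    using assms by (metis eq_iff_diff_eq_0 mult_eq_0_iff)
qed

text \<open>\<open>a\<close> is a root of \<open>(T - c) (T - d)\<close>, since this polynomial
  equals \<open>(T - a) (T - b)\<close>.\<close>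

lemma add_eq_mult_eq_cases:
  fixes a b c d :: "'a::idom"
  assumes "a + b = c + d" "a * b = c * d"
  shows "a = c \<and> b = d \<or> a = d \<and> b = c"
proof -
  have "(a - c) * (a - d) = a * a - a * (c + d) + c * d"
    by (simp add: algebra_simps)
  also have "\<dots> = 0"
    unfolding assms[symmetric] by (simp add: algebra_simps)
  finally have "a = c \<or> a = d"
    by (metis eq_iff_diff_eq_0 mult_eq_0_iff)
  then show ?thesis
    using assms(1) by (metis add.commute add_left_cancel)
qed

lemma alg_closed_sum_prod:
  fixes x y :: "'a::alg_closed_field"
  obtains u v where "x = u + v" "y = u * v"
proof -
  obtain u where "poly [:y, - x, 1:] u = 0"
    using alg_closed_imp_poly_has_root[of "[:y, - x, 1:]"] by auto
  then have "y = u * (x - u)"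
    by (simp add: algebra_simps add_eq_0_iff2)
  then show thesis
    using that[of u "x - u"] by simp
qed

lemma alg_closed_add_inverse:
  fixes u :: "'a::alg_closed_field"
  obtains a where "a \<noteq> 0" "u = a + inverse a"
proof -
  obtain a b where "u = a + b" "1 = a * b"
    by (rule alg_closed_sum_prod)
  then show thesis
    using that[of a] by (metis inverse_unique mult_zero_left zero_neq_one)
qed

text \<open>Any root of \<open>1 + T + ... + T ^ (d - 1)\<close> works: the value of this polynomial
  at 1 is \<open>d\<close>, which is nonzero in the field.\<close>

lemma alg_closed_root_of_unity:
  assumes "of_nat d \<noteq> (0::'a::alg_closed_field)" "d > 1"
  obtains z :: "'a::alg_closed_field" where "z ^ d = 1" "z \<noteq> 1"
proof -
  obtain z :: 'a where "(\<Sum>k\<le>d - 1. 1 * z ^ k) = 0"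
    using alg_closed[of "d - 1" "\<lambda>_. 1"] assms by auto
  moreover have "{..d - 1} = {..<d}"
    using assms by auto
  ultimately have z: "(\<Sum>k<d. z ^ k) = 0"
    by simp
  then have "z ^ d = 1"
    using power_diff_1_eq[of z d] by simp
  moreover have "z \<noteq> 1"
    using z assms by auto
  ultimately show thesis
    by (rule that)
qed

lemma power_eq_1_coprime:
  fixes z :: "'a::monoid_mult"
  assumes "z ^ m = 1" "z ^ n = 1" "coprime m n"
  shows "z = 1"
proof (cases "m = 0")
  \<comment> \<open>Here coprimality forces \<open>n = 1\<close>; Bezout over the naturals needs
    \<open>m\<close> nonzero.\<close>
  case True
  then show ?thesis using assms by simp
next
  case False
  then obtain x y where "m * x = n * y + 1"
    using bezout_nat[of m n] assms(3) by auto
  then have "z ^ (m * x) = z ^ (n * y) * z"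
    by (simp only: power_add power_one_right)
  then show ?thesis
    by (simp add: power_mult assms)
qed

section \<open>Finite fields and Frobenius\<close>

lemma finite_field_power_card:
  fixes x :: "'a::{field,finite}"
  shows "x ^ card (UNIV :: 'a set) = x"
proof (cases "x = 0")
  case False
  \<comment> \<open>Multiplication by \<open>x\<close> permutes the nonzero elements; cancelling
    their product gives Fermat's identity.\<close>
  have "(\<Prod>y\<in>UNIV-{0}. x * y) = (\<Prod>y\<in>UNIV-{0}. y)"
    by (rule prod.reindex_bij_witness[of _ "\<lambda>y. y / x" "\<lambda>y. x * y"]) (use False in auto)
  then have "x ^ (card (UNIV :: 'a set) - 1) = 1"
    by (simp add: prod.distrib)
  then show ?thesis
    by (metis power_eq_if finite_UNIV_card_ge_0 finite mult.right_neutral less_numeral_extra(3))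
qed (simp add: card_gt_0_iff)

locale finite_field_closure =
  fixes ty :: "'a::{field,finite} itself" and p q n :: nat
  assumes prime_p: "prime p" and n: "n \<ge> 1" and q_def: "q = p ^ n"
    and card_UNIV: "card (UNIV :: 'a set) = q"
begin

lemma CHAR_eq: "CHAR('a) = p"
proof -
  have "prime CHAR('a)"
    by (simp add: prime_CHAR_semidom finite_imp_CHAR_pos)
  moreover have "CHAR('a) dvd p ^ n"
    using CHAR_dvd_CARD[where 'a = 'a] card_UNIV q_def by simp
  ultimately show ?thesis
    using prime_p by (metis prime_dvd_power primes_dvd_imp_eq)
qed

lemma q_gt_1: "q > 1"
  unfolding q_def by (rule one_less_power) (use n prime_gt_1_nat[OF prime_p] in simp_all)

lemma frobenius_add: "(x + y) ^ q = x ^ q + (y ^ q :: 'a alg_closure)"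
  by (rule freshmans_dream') (use prime_p in \<open>simp_all add: CHAR_eq q_def\<close>)

text \<open>The embedded field supplies \<open>q\<close> fixed points, and \<open>T ^ q - T\<close>
  has at most \<open>q\<close> roots.\<close>

lemma frobenius_fixed_iff: "x ^ q = x \<longleftrightarrow> x \<in> range (to_ac :: 'a \<Rightarrow> 'a alg_closure)"
proof
  assume "x ^ q = x"
  let ?P = "monom 1 q - [:0, 1:] :: 'a alg_closure poly"
  have "coeff ?P q = 1"
    using q_gt_1 by (simp add: coeff_pCons split: nat.split)
  then have P0: "?P \<noteq> 0"
    by (rule contrapos_pn[of "coeff ?P q = 1"]) (simp only: coeff_0 zero_neq_one simp_thms)
  have roots: "{x. poly ?P x = 0} = {x. x ^ q = x}"
    by (simp add: poly_monom)
  have "degree ?P \<le> q"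
    using q_gt_1 by (intro degree_diff_le) (simp_all add: degree_monom_le)
  then have card: "card {x :: 'a alg_closure. x ^ q = x} \<le> q"
    and fin: "finite {x :: 'a alg_closure. x ^ q = x}"
    using card_poly_roots_bound[OF P0] poly_roots_finite[OF P0]
    by (simp_all add: roots poly_monom)
  have "card (range (to_ac :: 'a \<Rightarrow> 'a alg_closure)) = q"
    by (simp add: card_image inj_to_ac card_UNIV)
  moreover have "range to_ac \<subseteq> {x :: 'a alg_closure. x ^ q = x}"
    using finite_field_power_card[where 'a = 'a] by (auto simp: card_UNIV simp flip: to_ac_power)
  ultimately have "range to_ac = {x :: 'a alg_closure. x ^ q = x}"
    using card by (intro card_seteq[OF fin]) simp_all
  with \<open>x ^ q = x\<close> show "x \<in> range to_ac" by simp
next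
  assume "x \<in> range to_ac"
  then show "x ^ q = x"
    using finite_field_power_card[where 'a = 'a] by (auto simp: card_UNIV simp flip: to_ac_power)
qed

lemma frobenius2_add: "(x + y) ^ q\<^sup>2 = x ^ q\<^sup>2 + (y ^ q\<^sup>2 :: 'a alg_closure)"
  by (simp add: power2_eq_square power_mult frobenius_add)

text \<open>
  The Frobenius map permutes the two roots of \<open>T\<^sup>2 - x T + y\<close>, so its square fixes them.
\<close>

lemma sum_prod_roots:
  obtains u v :: "'a alg_closure"
  where "to_ac x = u + v" "to_ac y = u * v" "u ^ q\<^sup>2 = u" "v ^ q\<^sup>2 = v"
proof -
  obtain u v :: "'a alg_closure" where uv: "to_ac x = u + v" "to_ac y = u * v"
    by (rule alg_closed_sum_prod)
  have "to_ac x ^ q = to_ac x" "to_ac y ^ q = to_ac y"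
    by (simp_all add: frobenius_fixed_iff)
  then have "u ^ q + v ^ q = u + v" "u ^ q * v ^ q = u * v"
    by (simp_all add: uv frobenius_add power_mult_distrib)
  then have "u ^ q = u \<and> v ^ q = v \<or> u ^ q = v \<and> v ^ q = u"
    by (rule add_eq_mult_eq_cases)
  then have "u ^ q\<^sup>2 = u" "v ^ q\<^sup>2 = v"
    by (auto simp: power2_eq_square power_mult)
  with uv show thesis
    by (rule that)
qed

text \<open>The \<open>q\<^sup>2\<close>-power map fixes or inverts \<open>a\<close>, so applying it
  twice fixes \<open>a\<close>.\<close>

lemma add_inverse_parameter:
  fixes u :: "'a alg_closure"
  assumes "u ^ q\<^sup>2 = u"
  obtains a where "a \<noteq> 0" "u = a + inverse a" "a ^ (q ^ 4 - 1) = 1"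
proof -
  obtain a where a: "a \<noteq> 0" "u = a + inverse a"
    by (rule alg_closed_add_inverse)
  have "a ^ q\<^sup>2 + inverse (a ^ q\<^sup>2) = a + inverse a"
    using assms by (simp add: a frobenius2_add power_inverse)
  then have "a ^ q\<^sup>2 = a \<or> a ^ q\<^sup>2 = inverse a"
    using a by (subst (asm) add_inverse_eq_iff) auto
  then have "(a ^ q\<^sup>2) ^ q\<^sup>2 = a"
    by (auto simp: power_inverse)
  then have "a ^ q ^ 4 = a"
    by (simp only: power_mult[symmetric] power_add[symmetric]) simp
  then have "a * a ^ (q ^ 4 - 1) = a * 1"
    using q_gt_1 by (simp flip: power_Suc)
  with a show thesis
    by (intro that) simp_all
qed

section \<open>Injectivity and coprimality of \<open>k\<close> to \<open>q ^ 4 - 1\<close>\<close>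

lemma dickson_inj:
  fixes u w :: "'a alg_closure"
  assumes "coprime (q ^ 4 - 1) k" "u ^ q\<^sup>2 = u" "w ^ q\<^sup>2 = w" "dickson k u = dickson k w"
  shows "u = w"
proof -
  obtain a where a: "a \<noteq> 0" "u = a + inverse a" "a ^ (q ^ 4 - 1) = 1"
    using assms(2) by (rule add_inverse_parameter)
  obtain b where b: "b \<noteq> 0" "w = b + inverse b" "b ^ (q ^ 4 - 1) = 1"
    using assms(3) by (rule add_inverse_parameter)
  \<comment> \<open>Taking \<open>k\<close>-th powers is injective on roots of unity of order
    dividing \<open>q ^ 4 - 1\<close>: the order of \<open>c / d\<close> divides two coprime
    numbers.\<close>
  have eq: "c = d" if "c ^ (q ^ 4 - 1) = 1" "d ^ (q ^ 4 - 1) = 1" "c ^ k = d ^ k" "d \<noteq> 0"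
    for c d :: "'a alg_closure"
  proof -
    have "c / d = 1"
      by (rule power_eq_1_coprime[OF _ _ assms(1)]) (use that in \<open>simp_all add: power_divide\<close>)
    then show ?thesis using that by simp
  qed
  have "a ^ k + inverse (a ^ k) = b ^ k + inverse (b ^ k)"
    using assms(4) a b by (simp add: dickson_add_inverse power_inverse)
  then have "a ^ k = b ^ k \<or> a ^ k = inverse b ^ k"
    using a b by (subst (asm) add_inverse_eq_iff) (auto simp: power_inverse)
  then have "a = b \<or> a = inverse b"
    using eq[of a b] eq[of a "inverse b"] a b by (auto simp: power_inverse)
  then show ?thesis
    using a b by auto
qed

lemma inj_B2_poly:
  assumes "coprime (q ^ 4 - 1) k"
  shows "inj (int_poly2_map (B2_poly k) :: 'a \<times> 'a \<Rightarrow> 'a \<times> 'a)"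
proof (rule injI, clarify)
  fix x y x' y' :: 'a
  assume eq: "int_poly2_map (B2_poly k) (x, y) = int_poly2_map (B2_poly k) (x', y')"
  obtain u v where uv: "to_ac x = u + v" "to_ac y = u * v" "u ^ q\<^sup>2 = u" "v ^ q\<^sup>2 = v"
    by (rule sum_prod_roots)
  obtain u' v' where uv': "to_ac x' = u' + v'" "to_ac y' = u' * v'" "u' ^ q\<^sup>2 = u'" "v' ^ q\<^sup>2 = v'"
    by (rule sum_prod_roots)
  have "int_poly2_map (B2_poly k) (u + v, u * v) = int_poly2_map (B2_poly k) (u' + v', u' * v')"
    using arg_cong[OF eq, of "map_prod to_ac to_ac"] uv uv'
    by (simp add: map_prod_to_ac_int_poly2_map)
  then have "dickson k u = dickson k u' \<and> dickson k v = dickson k v' \<or>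
      dickson k u = dickson k v' \<and> dickson k v = dickson k u'"
    by (intro add_eq_mult_eq_cases) (simp_all add: int_poly2_map_B2_poly)
  then have "u = u' \<and> v = v' \<or> u = v' \<and> v = u'"
    using dickson_inj[OF assms] uv uv' by blast
  then have "to_ac x = to_ac x'" "to_ac y = to_ac y'"
    using uv uv' by (auto simp: add.commute mult.commute)
  then show "x = x' \<and> y = y'"
    by simp
qed

text \<open>
  A nontrivial root of unity \<open>z\<close> of prime order dividing both \<open>k\<close> and \<open>q\<^sup>4 - 1\<close> yields
  \<open>u = z + z\<^sup>-\<^sup>1\<close> in the field with \<open>q\<^sup>2\<close> elements, and the conjugate pair \<open>u, u\<^sup>q\<close> collides
  with the pair \<open>2, 2\<close>.
\<close>

lemma coprime_if_inj_B2_poly: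
  assumes "inj (int_poly2_map (B2_poly k) :: 'a \<times> 'a \<Rightarrow> 'a \<times> 'a)"
  shows "coprime (q ^ 4 - 1) k"
proof (rule ccontr)
  assume "\<not> coprime (q ^ 4 - 1) k"
  then have "gcd (q ^ 4 - 1) k \<noteq> 1"
    by (simp add: coprime_iff_gcd_eq_1)
  then obtain l where "prime l" "l dvd gcd (q ^ 4 - 1) k"
    using prime_factor_nat by blast
  then have l: "prime l" "l dvd q ^ 4 - 1" "l dvd k"
    by (blast intro: dvd_trans)+
  \<comment> \<open>\<open>p\<close> divides \<open>q ^ 4\<close>, hence not
    \<open>q ^ 4 - 1\<close>, so \<open>l\<close> differs from the characteristic.\<close>
  have "of_nat l \<noteq> (0 :: 'a alg_closure)"
  proof
    assume "of_nat l = (0 :: 'a alg_closure)"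
    then have "p dvd l"
      by (simp add: of_nat_eq_0_iff_char_dvd CHAR_eq)
    then have "p dvd q ^ 4 - 1"
      using l(2) by (rule dvd_trans)
    moreover have "p dvd q ^ 4"
      unfolding q_def power_mult[symmetric] by (rule dvd_power) (use n in simp)
    ultimately have "p dvd q ^ 4 - (q ^ 4 - 1)"
      by (rule dvd_diff_nat[rotated])
    moreover have "q ^ 4 - (q ^ 4 - 1) = 1"
      using q_gt_1 by (intro diff_diff_cancel one_le_power) simp
    ultimately have "p dvd 1"
      by metis
    then show False
      using prime_p by (simp add: not_prime_unit)
  qed
  then obtain z :: "'a alg_closure" where z: "z ^ l = 1" "z \<noteq> 1"
    using prime_gt_1_nat[OF l(1)] by (rule alg_closed_root_of_unity)
  have [simp]: "z \<noteq> 0"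
    using z prime_gt_0_nat[OF l(1)] by (auto simp: power_0_left)
  define u where "u = z + inverse z"
  have u_q: "u ^ q = z ^ q + inverse (z ^ q)"
    by (simp add: u_def frobenius_add power_inverse)
  have "m * m - 1 = (m - 1) * (m + 1)" for m :: nat
    by (cases m) simp_all
  from this[of "q\<^sup>2"] have "q ^ 4 - 1 = (q\<^sup>2 - 1) * (q\<^sup>2 + 1)"
    by (simp flip: power_add)
  then consider "l dvd q\<^sup>2 - 1" | "l dvd q\<^sup>2 + 1"
    using l(2) prime_dvd_mult_iff[OF l(1)] by metis
  \<comment> \<open>The \<open>q\<^sup>2\<close>-power map fixes \<open>z\<close> in the first case
    and inverts it in the second.\<close>
  then have "u ^ q\<^sup>2 = u"
  proof cases
    case 1
    then have "z ^ (q\<^sup>2 - 1) = 1"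
      using z by (auto elim!: dvdE simp: power_mult)
    then have "z ^ Suc (q\<^sup>2 - 1) = z"
      by simp
    then have "z ^ q\<^sup>2 = z"
      using q_gt_1 by (simp del: power_Suc)
    then show ?thesis
      by (simp add: u_def frobenius2_add power_inverse)
  next
    case 2
    then have "z ^ (q\<^sup>2 + 1) = 1"
      using z by (auto elim!: dvdE simp only: power_mult power_one)
    then have "z ^ q\<^sup>2 = inverse z"
      by (intro inverse_unique[symmetric]) simp
    then show ?thesis
      by (simp add: u_def frobenius2_add power_inverse)
  qed
  then have u_q_q: "(u ^ q) ^ q = u"
    by (simp add: power2_eq_square power_mult)
  \<comment> \<open>Frobenius swaps \<open>u\<close> and \<open>u ^ q\<close>, so their sum and
    product lie in the base field.\<close>
  have "(u + u ^ q) ^ q = u + u ^ q" "(u * u ^ q) ^ q = u * u ^ q"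
    by (simp_all add: frobenius_add power_mult_distrib u_q_q add.commute mult.commute)
  then obtain x y where xy: "to_ac x = u + u ^ q" "to_ac y = u * u ^ q"
    by (metis frobenius_fixed_iff rangeE)
  have z_k: "z ^ k = 1"
    using z l(3) by (auto elim!: dvdE simp: power_mult)
  have dickson_2: "dickson k (2 :: 'b::field) = 2"
    using dickson_add_inverse[of "1 :: 'b" k] by simp
  have "dickson k u = 2"
    unfolding u_def by (simp add: dickson_add_inverse z_k power_inverse)
  moreover have "dickson k (u ^ q) = 2"
  proof -
    have "(z ^ q) ^ k = 1"
      using z_k by (simp only: power_mult[symmetric] mult.commute[of q]) (simp only: power_mult power_one)
    then show ?thesis
      unfolding u_q by (simp add: dickson_add_inverse power_inverse del: power_mult)
  qed
  ultimately have "int_poly2_map (B2_poly k) (u + u ^ q, u * u ^ q) = (2 + 2, 2 * 2)"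
    by (simp only: int_poly2_map_B2_poly)
  moreover have "int_poly2_map (B2_poly k) (2 + 2, 2 * 2) = (2 + 2 :: 'a alg_closure, 2 * 2)"
    by (simp only: int_poly2_map_B2_poly dickson_2)
  ultimately have "map_prod to_ac to_ac (int_poly2_map (B2_poly k) (x, y))
      = map_prod to_ac to_ac (int_poly2_map (B2_poly k) (2 + 2, 2 * 2))"
    by (simp add: map_prod_to_ac_int_poly2_map xy)
  then have "int_poly2_map (B2_poly k) (x, y) = int_poly2_map (B2_poly k) (2 + 2, 2 * 2)"
    by (simp add: map_prod_def prod_eq_iff split: prod.splits)
  then have "(x, y) = (2 + 2, 2 * 2)"
    by (rule injD[OF assms])
  then have "u + u ^ q = 2 + 2" "u * u ^ q = 2 * 2"
    by (simp_all flip: xy)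
  \<comment> \<open>Since \<open>2 = 1 + inverse 1\<close>, this forces
    \<open>z = 1\<close>.\<close>
  then have "u = 2"
    using add_eq_mult_eq_cases by blast
  then have "z + inverse z = 1 + inverse 1"
    by (simp add: u_def)
  then show False
    using z by (subst (asm) add_inverse_eq_iff) simp_all
qed

end

theorem theorem2p5:
  fixes p q n k :: nat
  assumes "prime p" and "n \<ge> 1" and "q = p ^ n"
    and "card (UNIV :: 'a::{field,finite} set) = q"
  shows "bij (int_poly2_map (B2_poly k) :: 'a \<times> 'a \<Rightarrow> 'a \<times> 'a) \<longleftrightarrow> gcd (q ^ 4 - 1) k = 1"
proof -
  interpret finite_field_closure "TYPE('a)" p q n
    by unfold_locales (fact assms)+
  have "bij (int_poly2_map (B2_poly k) :: 'a \<times> 'a \<Rightarrow> 'a \<times> 'a)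
      \<longleftrightarrow> inj (int_poly2_map (B2_poly k) :: 'a \<times> 'a \<Rightarrow> 'a \<times> 'a)"
    unfolding bij_def using finite_UNIV_inj_surj[OF finite] by blast
  then show ?thesis
    using inj_B2_poly[of k] coprime_if_inj_B2_poly[of k]
    unfolding coprime_iff_gcd_eq_1 by argo
qed

end
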